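(* Consider a scenario tree with horizon $N\ge 1$, node probabilities $\pi^i>0$ and disturbance values $w^i$, together with dynamics $f$, stage cost $\ell$ and terminal cost $V_f$, as described in the context, where $f$ and $\ell$ are differentiable in $(x,u)$ and $V_f$ is differentiable. Let $x\in\mathbb{R}^{n_x}$ and $u=(u^i)_{i\in\mathbf{nodes}(0,N-1)}$ with $u^i\in\mathbb{R}^{n_u}$, and let $V_N(x,u)$ be the total cost defined in the context. Define vectors $a^i\in\mathbb{R}^{n_x}$ backwards along the tree by $$a^i=V_f^{\prime i}\quad\text{for } i\in\mathbf{nodes}(N),$$ $$a^i=\sum_{i_+\in\mathbf{ch}(i)}\pi^{i_+}\bigl(\ell_x^{i_+}+f_x^{i_+}(a^{i_+})\bigr)\quad\text{for } i\in\mathbf{nodes}(N-1),$$ $$a^i=\sum_{i_+\in\mathbf{ch}(i)}\bigl(\pi^{i_+}\ell_x^{i_+}+f_x^{i_+}(a^{i_+})\bigr)\quad\text{for } i\in\mathbf{nodes}(1,N-2).$$ Then the gradient of $V_N$ with respect to the inputs is given by $$\nabla_{u^i}V_N(x,u)=\sum_{i_+\in\mathbf{ch}(i)}\pi^{i_+}\bigl(\ell_u^{i_+}+f_u^{i_+}(a^{i_+})\bigr)\quad\text{for } i\in\mathbf{nodes}(N-1),$$ $$\nabla_{u^i}V_N(x,u)=\sum_{i_+\in\mathbf{ch}(i)}\bigl(\pi^{i_+}\ell_u^{i_+}+f_u^{i_+}(a^{i_+})\bigr)\quad\text{for } i\in\mathbf{nodes}(0,N-2).$$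
   Context: Scenario tree: a finite rooted tree whose nodes are partitioned into stages $t=0,1,\ldots,N$. $\mathbf{nodes}(t)$ is the set of nodes at stage $t$, with $\mathbf{nodes}(0)=\{0\}$ (the root), and $\mathbf{nodes}(t_1,t_2)=\bigcup_{\tau=t_1}^{t_2}\mathbf{nodes}(\tau)$ (empty if $t_2<t_1$). The nodes at stage $N$ are the leaf nodes; all others are nonleaf. Every node $i$ at a stage $t\ge 1$ is connected to a single node at stage $t-1$, its ancestor $\mathbf{anc}(i)$. Every node $i$ at a stage $t\le N-1$ leads up to a set of children $\mathbf{ch}(i)\subseteq\mathbf{nodes}(t+1)$, namely the nodes whose ancestor is $i$. The probability of occurrence of node $i$ is $\pi^i>0$. Each nonroot node $i$ carries a disturbance value $w^i$ in some set $W$, and each nonleaf node $i$ carries an input $u^i\in\mathbb{R}^{n_u}$. Data: $f:\mathbb{R}^{n_x}\times\mathbb{R}^{n_u}\times W\to\mathbb{R}^{n_x}$, $\ell:\mathbb{R}^{n_x}\times\mathbb{R}^{n_u}\times W\to\mathbb{R}$ and $V_f:\mathbb{R}^{n_x}\to\mathbb{R}$. Given $x$ and $u$, the states are defined by $x^0=x$ and $x^i=f(x^{\mathbf{anc}(i)},u^{\mathbf{anc}(i)},w^i)$ for $i\in\mathbf{nodes}(1,N)$. The total cost, as a function of $(x,u)$ with the states eliminated in this way, is $$V_N(x,u)=\sum_{i\in\mathbf{nodes}(1,N)}\pi^i\,\ell(x^{\mathbf{anc}(i)},u^{\mathbf{anc}(i)},w^i)+\sum_{j\in\mathbf{nodes}(N)}\pi^jV_f(x^j).$$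 Notation: $J_xf$, $J_uf$ are the Jacobian matrices of $f$ with respect to its first and second arguments; gradients are column vectors, with $\nabla_x\ell$ and $\nabla_u\ell$ taken with respect to the first and second arguments; $\nabla_{u^i}V_N$ is the gradient of $V_N$ with respect to the block $u^i$ of $u$. For $i\in\mathbf{nodes}(1,N)$ and $d\in\mathbb{R}^{n_x}$, set $\ell_x^i=\nabla_x\ell(x^{\mathbf{anc}(i)},u^{\mathbf{anc}(i)},w^i)$, $\ell_u^i=\nabla_u\ell(x^{\mathbf{anc}(i)},u^{\mathbf{anc}(i)},w^i)$, $f_x^i(d)=J_xf(x^{\mathbf{anc}(i)},u^{\mathbf{anc}(i)},w^i)^{\top}d$ and $f_u^i(d)=J_uf(x^{\mathbf{anc}(i)},u^{\mathbf{anc}(i)},w^i)^{\top}d$. For $i\in\mathbf{nodes}(N)$, set $V_f^{\prime i}=\nabla V_f(x^i)$. *)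

theory Defs
  imports "HOL-Analysis.Analysis"
begin

record 'i tree =
  horizon :: nat
  nodes :: "nat \<Rightarrow> 'i set"
  root_node :: 'i
  anc :: "'i \<Rightarrow> 'i"

text \<open>
  Only the stages \<open>0, \<dots>, N\<close> and the ancestors of nonroot nodes are constrained; the values of
  \<open>nodes\<close> and \<open>anc\<close> elsewhere are irrelevant.
\<close>

definition scenario_tree :: "'i tree \<Rightarrow> bool" where
  "scenario_tree T \<longleftrightarrow>
     nodes T 0 = {root_node T} \<and>
     (\<forall>t \<le> horizon T. finite (nodes T t)) \<and>
     (\<forall>s \<le> horizon T. \<forall>t \<le> horizon T. s \<noteq> t \<longrightarrow> nodes T s \<inter> nodes T t = {}) \<and>
     (\<forall>t < horizon T. \<forall>i \<in> nodes T (Suc t). anc T i \<in> nodes T t)"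

text \<open>Integer bounds, so that \<open>nodes(0, N - 2)\<close> is empty for \<open>N = 1\<close>.\<close>

definition nodes_range :: "'i tree \<Rightarrow> int \<Rightarrow> int \<Rightarrow> 'i set" where
  "nodes_range T t1 t2 = (\<Union>\<tau> \<in> {\<tau>. t1 \<le> int \<tau> \<and> int \<tau> \<le> t2}. nodes T \<tau>)"

definition ch :: "'i tree \<Rightarrow> 'i \<Rightarrow> 'i set" where
  "ch T i = {j \<in> nodes_range T 1 (int (horizon T)). anc T j = i}"

definition stage :: "'i tree \<Rightarrow> 'i \<Rightarrow> nat" where
  "stage T i = (THE t. t \<le> horizon T \<and> i \<in> nodes T t)"

text \<open>
  The states are computed by recursion on the stage; the lemmas \<open>state_root\<close> and \<open>state_step\<close>
  below recover the defining equations in terms of nodes.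
\<close>

primrec state_at ::
  "'i tree \<Rightarrow> ('i \<Rightarrow> 'w) \<Rightarrow> ('s \<Rightarrow> 'c \<Rightarrow> 'w \<Rightarrow> 's) \<Rightarrow> 's \<Rightarrow> ('i \<Rightarrow> 'c) \<Rightarrow> nat \<Rightarrow> 'i \<Rightarrow> 's"
where
  "state_at T w f x u 0 i = x"
| "state_at T w f x u (Suc t) i = f (state_at T w f x u t (anc T i)) (u (anc T i)) (w i)"

definition state ::
  "'i tree \<Rightarrow> ('i \<Rightarrow> 'w) \<Rightarrow> ('s \<Rightarrow> 'c \<Rightarrow> 'w \<Rightarrow> 's) \<Rightarrow> 's \<Rightarrow> ('i \<Rightarrow> 'c) \<Rightarrow> 'i \<Rightarrow> 's"
where
  "state T w f x u i = state_at T w f x u (stage T i) i"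

lemma stage_eq:
  assumes "scenario_tree T" "t \<le> horizon T" "i \<in> nodes T t"
  shows "stage T i = t"
  unfolding stage_def
  using assms by (intro the_equality) (simp, metis disjoint_iff scenario_tree_def)

lemma state_root:
  assumes "scenario_tree T"
  shows "state T w f x u (root_node T) = x"
proof -
  have "stage T (root_node T) = 0"
    using assms by (intro stage_eq) (auto simp: scenario_tree_def)
  then show ?thesis by (simp add: state_def)
qed

lemma state_step:
  assumes T: "scenario_tree T" and i: "i \<in> nodes_range T 1 (int (horizon T))"
  shows "state T w f x u i = f (state T w f x u (anc T i)) (u (anc T i)) (w i)"
proof -
  from i obtain s where s: "1 \<le> s" "s \<le> horizon T" "i \<in> nodes T s"
    by (auto simp: nodes_range_def)
  then obtain t where t: "s = Suc t" by (cases s) auto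
  have "anc T i \<in> nodes T t"
    using T s t by (auto simp: scenario_tree_def)
  then have "stage T i = Suc t" "stage T (anc T i) = t"
    using s t by (auto intro!: stage_eq[OF T])
  then show ?thesis by (simp add: state_def)
qed

definition total_cost ::
  "'i tree \<Rightarrow> ('i \<Rightarrow> real) \<Rightarrow> ('i \<Rightarrow> 'w) \<Rightarrow> ('s \<Rightarrow> 'c \<Rightarrow> 'w \<Rightarrow> 's) \<Rightarrow> ('s \<Rightarrow> 'c \<Rightarrow> 'w \<Rightarrow> real) \<Rightarrow> ('s \<Rightarrow> real) \<Rightarrow>
   's \<Rightarrow> ('i \<Rightarrow> 'c) \<Rightarrow> real"
where
  "total_cost T \<pi> w f l Vf x u =
     (\<Sum>i \<in> nodes_range T 1 (int (horizon T)).
        \<pi> i * l (state T w f x u (anc T i)) (u (anc T i)) (w i)) +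
     (\<Sum>j \<in> nodes T (horizon T). \<pi> j * Vf (state T w f x u j))"

definition grad :: "('a::real_inner \<Rightarrow> real) \<Rightarrow> 'a \<Rightarrow> 'a" where
  "grad g z = (THE D. GDERIV g z :> D)"

lemma grad_eqI:
  assumes "GDERIV g z :> D"
  shows "grad g z = D"
  unfolding grad_def
proof (rule the_equality[where P = "\<lambda>D. GDERIV g z :> D", OF assms])
  fix E assume "GDERIV g z :> E"
  then have "(\<lambda>h. inner h E) = (\<lambda>h. inner h D)"
    using assms has_derivative_unique unfolding gderiv_def by blast
  then have "inner (E - D) (E - D) = 0"
    by (metis inner_diff_right right_minus_eq)
  then show "E = D" by simp
qed

definition l_x where
  "l_x T w f l x u i = grad (\<lambda>\<xi>. l \<xi> (u (anc T i)) (w i)) (state T w f x u (anc T i))"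

definition l_u where
  "l_u T w f l x u i = grad (\<lambda>\<upsilon>. l (state T w f x u (anc T i)) \<upsilon> (w i)) (u (anc T i))"

definition f_x ::
  "'i tree \<Rightarrow> ('i \<Rightarrow> 'w) \<Rightarrow> (real^'nx \<Rightarrow> real^'nu \<Rightarrow> 'w \<Rightarrow> real^'nx) \<Rightarrow>
   real^'nx \<Rightarrow> ('i \<Rightarrow> real^'nu) \<Rightarrow> 'i \<Rightarrow> real^'nx \<Rightarrow> real^'nx"
where
  "f_x T w f x u i d =
     transpose (jacobian (\<lambda>\<xi>. f \<xi> (u (anc T i)) (w i)) (at (state T w f x u (anc T i)))) *v d"

definition f_u ::
  "'i tree \<Rightarrow> ('i \<Rightarrow> 'w) \<Rightarrow> (real^'nx \<Rightarrow> real^'nu \<Rightarrow> 'w \<Rightarrow> real^'nx) \<Rightarrow>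
   real^'nx \<Rightarrow> ('i \<Rightarrow> real^'nu) \<Rightarrow> 'i \<Rightarrow> real^'nx \<Rightarrow> real^'nu"
where
  "f_u T w f x u i d =
     transpose (jacobian (\<lambda>\<upsilon>. f (state T w f x u (anc T i)) \<upsilon> (w i)) (at (u (anc T i)))) *v d"

definition Vf_x where
  "Vf_x T w f Vf x u i = grad Vf (state T w f x u i)"

end

theory Submission
  imports Defs
begin

text \<open>
  The gradient is computed by the adjoint (reverse accumulation) method. The sensitivities
  \<open>X\<^sup>j\<close> of the states to a variation of the inputs obey the dynamics linearised along the
  trajectory, started at zero in the root. Rescale the given vectors to adjoints \<open>b\<close> by putting
  \<open>b\<^sup>j = \<pi>\<^sup>j V\<^sub>f'\<^sup>j\<close> at the leaves and \<open>b\<^sup>j = a\<^sup>j\<close> elsewhere: the factor \<open>\<pi>\<close> that distinguishes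
  the last stage from the others is absorbed, since \<open>f\<^sub>x\<close> and \<open>f\<^sub>u\<close> are linear in \<open>d\<close>, and one
  recursion then holds at all nodes that are neither the root nor leaves.

  In the sum over all nonroot nodes of (variation of the stage cost) \<open>+ X\<^sup>j \<bullet> b\<^sup>j\<close>, expand each
  term by the linearised dynamics and collect the nodes by their ancestor \<open>k\<close>. By the recursion,
  the part that depends on \<open>X\<^sup>k\<close> collapses to \<open>X\<^sup>k \<bullet> b\<^sup>k\<close>, and what remains is the variation of the
  input at \<open>k\<close> paired with the claimed gradient. The terms \<open>X\<^sup>k \<bullet> b\<^sup>k\<close> of the intermediate nodes occur
  on both sides and cancel; the root contributes nothing because \<open>X\<close> vanishes there, and the leaf
  terms are exactly the variation of the terminal cost. Lemma \<open>total_cost_has_derivative\<close> carries this out for inputs that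
  depend on an arbitrary parameter; the theorem is the case where the parameter is one block
  of the input.
\<close>

section \<open>Stages, children and induction along a scenario tree\<close>

lemma finite_nodes_range:
  assumes "scenario_tree T" "t \<le> int (horizon T)"
  shows "finite (nodes_range T s t)"
proof -
  have "{\<tau>. s \<le> int \<tau> \<and> int \<tau> \<le> t} \<subseteq> {..horizon T}"
    using assms(2) by auto
  then have "finite {\<tau>. s \<le> int \<tau> \<and> int \<tau> \<le> t}"
    using finite_subset by blast
  then show ?thesis
    using assms unfolding nodes_range_def scenario_tree_def by auto
qed

lemma stage_nodes_range:
  assumes T: "scenario_tree T" and i: "i \<in> nodes_range T s t" and t: "t \<le> int (horizon T)"
  shows "s \<le> int (stage T i)" "int (stage T i) \<le> t"
proof -
  obtain \<tau> where \<tau>: "s \<le> int \<tau>" "int \<tau> \<le> t" "i \<in> nodes T \<tau>"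
    using i by (auto simp: nodes_range_def)
  moreover have "stage T i = \<tau>"
    using \<tau> t by (intro stage_eq[OF T]) auto
  ultimately show "s \<le> int (stage T i)" "int (stage T i) \<le> t"
    by auto
qed

lemma nodes_range_leaves:
  assumes T: "scenario_tree T" and N: "1 \<le> horizon T"
  shows "nodes_range T 1 (int (horizon T)) =
      nodes_range T 1 (int (horizon T) - 1) \<union> nodes T (horizon T)"
    and "nodes_range T 1 (int (horizon T) - 1) \<inter> nodes T (horizon T) = {}"
proof -
  have "{\<tau>. 1 \<le> int \<tau> \<and> int \<tau> \<le> int (horizon T)} =
      insert (horizon T) {\<tau>. 1 \<le> int \<tau> \<and> int \<tau> \<le> int (horizon T) - 1}"
    using N by auto
  then show "nodes_range T 1 (int (horizon T)) =
      nodes_range T 1 (int (horizon T) - 1) \<union> nodes T (horizon T)"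
    unfolding nodes_range_def by auto
  show "nodes_range T 1 (int (horizon T) - 1) \<inter> nodes T (horizon T) = {}"
    using stage_nodes_range[OF T, of _ 1 "int (horizon T) - 1"] stage_eq[OF T] by fastforce
qed

lemma nodes_range_root:
  assumes T: "scenario_tree T" and t: "0 \<le> t" "t \<le> int (horizon T)"
  shows "nodes_range T 0 t = insert (root_node T) (nodes_range T 1 t)"
    and "root_node T \<notin> nodes_range T 1 t"
proof -
  have root: "nodes T 0 = {root_node T}"
    using T by (simp add: scenario_tree_def)
  have "{\<tau>. 0 \<le> int \<tau> \<and> int \<tau> \<le> t} = insert 0 {\<tau>. 1 \<le> int \<tau> \<and> int \<tau> \<le> t}"
    using t by auto
  then show "nodes_range T 0 t = insert (root_node T) (nodes_range T 1 t)"
    unfolding nodes_range_def using root by auto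
  have "stage T (root_node T) = 0"
    using root by (intro stage_eq[OF T]) auto
  moreover have "1 \<le> stage T j" if "j \<in> nodes_range T 1 t" for j
    using stage_nodes_range(1)[OF T that t(2)] by simp
  ultimately show "root_node T \<notin> nodes_range T 1 t"
    by force
qed

lemma anc_in_nodes_range:
  assumes "scenario_tree T" "j \<in> nodes_range T 1 (int (horizon T))"
  shows "anc T j \<in> nodes_range T 0 (int (horizon T) - 1)"
proof -
  obtain s where s: "1 \<le> s" "s \<le> horizon T" "j \<in> nodes T s"
    using assms(2) by (auto simp: nodes_range_def)
  then obtain t where "s = Suc t"
    by (cases s) auto
  then have "anc T j \<in> nodes T t" "t < horizon T"
    using assms(1) s by (auto simp: scenario_tree_def)
  then show ?thesis
    by (auto simp: nodes_range_def)
qed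

lemma sum_over_children:
  assumes "scenario_tree T"
  shows "(\<Sum>j \<in> nodes_range T 1 (int (horizon T)). \<phi> j) =
    (\<Sum>k \<in> nodes_range T 0 (int (horizon T) - 1). \<Sum>j \<in> ch T k. \<phi> j)"
proof -
  have "anc T ` nodes_range T 1 (int (horizon T)) \<subseteq> nodes_range T 0 (int (horizon T) - 1)"
    using anc_in_nodes_range[OF assms] by blast
  then show ?thesis
    unfolding ch_def using assms by (intro sum.group[symmetric]) (auto intro: finite_nodes_range)
qed

lemma scenario_tree_induct [consumes 2, case_names root step]:
  assumes T: "scenario_tree T" and i: "i \<in> nodes_range T 0 (int (horizon T))"
    and root: "P (root_node T)"
    and step: "\<And>j. j \<in> nodes_range T 1 (int (horizon T)) \<Longrightarrow> P (anc T j) \<Longrightarrow> P j"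
  shows "P i"
proof -
  have "\<forall>j \<in> nodes T t. P j" if "t \<le> horizon T" for t
    using that
  proof (induction t)
    case 0
    then show ?case
      using T root by (simp add: scenario_tree_def)
  next
    case (Suc t)
    have "j \<in> nodes_range T 1 (int (horizon T))" if "j \<in> nodes T (Suc t)" for j
      using that Suc.prems unfolding nodes_range_def by force
    moreover have "P (anc T j)" if "j \<in> nodes T (Suc t)" for j
      using that Suc T by (auto simp: scenario_tree_def)
    ultimately show ?case
      using step by blast
  qed
  then show ?thesis
    using i by (auto simp: nodes_range_def)
qed

section \<open>Partial derivatives, gradients and Jacobians\<close>

text \<open>
  Joint differentiability makes the total derivative the sum of the partial ones. The partial
  derivatives themselves are the instances where one argument is constant, and so they are
  read off from the joint derivative by the same composition.
\<close>

lemma has_derivative_two_arguments: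
  fixes \<phi> :: "'a::real_normed_vector \<Rightarrow> 'b::real_normed_vector \<Rightarrow> 'c::real_normed_vector"
  assumes diff: "(\<lambda>(\<xi>, \<upsilon>). \<phi> \<xi> \<upsilon>) differentiable (at (g p, h p))"
    and g: "(g has_derivative g') (at p)" and h: "(h has_derivative h') (at p)"
  shows "((\<lambda>p. \<phi> (g p) (h p)) has_derivative
      (\<lambda>d. frechet_derivative (\<lambda>\<xi>. \<phi> \<xi> (h p)) (at (g p)) (g' d) +
           frechet_derivative (\<lambda>\<upsilon>. \<phi> (g p) \<upsilon>) (at (h p)) (h' d))) (at p)"
proof -
  obtain D where D: "((\<lambda>(\<xi>, \<upsilon>). \<phi> \<xi> \<upsilon>) has_derivative D) (at (g p, h p))"
    using diff by (auto simp: differentiable_def)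
  have comp: "((\<lambda>q. \<phi> (g1 q) (h1 q)) has_derivative (\<lambda>d. D (g1' d, h1' d))) (at q)"
    if "g1 q = g p" "h1 q = h p" "(g1 has_derivative g1') (at q)" "(h1 has_derivative h1') (at q)"
    for g1 h1 g1' h1' and q :: "'q::real_normed_vector"
    using has_derivative_compose[OF has_derivative_Pair[OF that(3,4)], of "\<lambda>(\<xi>, \<upsilon>). \<phi> \<xi> \<upsilon>" D] D that(1,2)
    by simp
  have x: "frechet_derivative (\<lambda>\<xi>. \<phi> \<xi> (h p)) (at (g p)) = (\<lambda>d. D (d, 0))"
    by (rule frechet_derivative_at[symmetric], rule comp) auto
  have u: "frechet_derivative (\<lambda>\<upsilon>. \<phi> (g p) \<upsilon>) (at (h p)) = (\<lambda>d. D (0, d))"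
    by (rule frechet_derivative_at[symmetric], rule comp) auto
  have D_split: "D (y, z) = D (y, 0) + D (0, z)" for y z
    using linear_add[OF has_derivative_linear[OF D], of "(y, 0)" "(0, z)"] by simp
  show ?thesis
    unfolding x u D_split[symmetric] by (rule comp[OF refl refl g h])
qed

lemma differentiable_partial:
  assumes "\<And>z. (\<lambda>(\<xi>, \<upsilon>). \<phi> \<xi> \<upsilon>) differentiable (at z)"
  shows "(\<lambda>\<xi>. \<phi> \<xi> \<upsilon>) differentiable (at \<xi>)" and "(\<lambda>\<upsilon>. \<phi> \<xi> \<upsilon>) differentiable (at \<upsilon>)"
  using has_derivative_two_arguments[of \<phi> "\<lambda>\<xi>. \<xi>" \<xi> "\<lambda>_. \<upsilon>" "\<lambda>d. d" "\<lambda>_. 0"]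
    has_derivative_two_arguments[of \<phi> "\<lambda>_. \<xi>" \<upsilon> "\<lambda>\<upsilon>. \<upsilon>" "\<lambda>_. 0" "\<lambda>d. d"] assms
  by (auto simp: differentiable_def)

text \<open>
  A derivative into the reals is the inner product with its adjoint applied to \<open>1\<close>, so the
  gradient exists.
\<close>

lemma inner_grad:
  fixes g :: "'a::euclidean_space \<Rightarrow> real"
  assumes "g differentiable (at z)"
  shows "h \<bullet> grad g z = frechet_derivative g (at z) h"
proof -
  have D: "(g has_derivative frechet_derivative g (at z)) (at z)"
    using assms by (simp add: frechet_derivative_works)
  have eq: "h \<bullet> adjoint (frechet_derivative g (at z)) 1 = frechet_derivative g (at z) h" for h
    using adjoint_works[OF has_derivative_linear[OF D], of h 1] by simp
  have "GDERIV g z :> adjoint (frechet_derivative g (at z)) 1"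
    unfolding gderiv_def eq using D by simp
  then show ?thesis
    using eq grad_eqI by metis
qed

lemma inner_transpose_jacobian:
  fixes g :: "real^'a \<Rightarrow> real^'b"
  assumes "g differentiable (at z)"
  shows "h \<bullet> (transpose (jacobian g (at z)) *v d) = frechet_derivative g (at z) h \<bullet> d"
proof -
  have "frechet_derivative g (at z) h = jacobian g (at z) *v h"
    using assms frechet_derivative_at jacobian_works by metis
  then show ?thesis
    by (metis dot_lmul_matrix inner_commute transpose_matrix_vector)
qed

section \<open>The derivative of the total cost by adjoints\<close>

text \<open>
  The recursion for \<open>b\<close> is required at the intermediate nodes only: a value at the root would be
  paired with the sensitivity of the initial state, which is zero.
\<close>

lemma total_cost_has_derivative:
  fixes T :: "'i tree"
    and f :: "real^'nx \<Rightarrow> real^'nu \<Rightarrow> 'w \<Rightarrow> real^'nx"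
    and U :: "'p::real_normed_vector \<Rightarrow> 'i \<Rightarrow> real^'nu"
  assumes T: "scenario_tree T" and N: "1 \<le> horizon T"
    and diff_f: "\<And>\<omega> z. (\<lambda>(\<xi>, \<upsilon>). f \<xi> \<upsilon> \<omega>) differentiable (at z)"
    and diff_l: "\<And>\<omega> z. (\<lambda>(\<xi>, \<upsilon>). l \<xi> \<upsilon> \<omega>) differentiable (at z)"
    and diff_Vf: "\<And>z. Vf differentiable (at z)"
    and U: "\<And>k. k \<in> nodes_range T 0 (int (horizon T) - 1) \<Longrightarrow>
      ((\<lambda>p. U p k) has_derivative U' k) (at p)"
    and b_leaf: "\<And>j. j \<in> nodes T (horizon T) \<Longrightarrow> b j = \<pi> j *\<^sub>R Vf_x T w f Vf x (U p) j"
    and b_inner: "\<And>k. k \<in> nodes_range T 1 (int (horizon T) - 1) \<Longrightarrow>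
      b k = (\<Sum>j \<in> ch T k. \<pi> j *\<^sub>R l_x T w f l x (U p) j + f_x T w f x (U p) j (b j))"
  shows "((\<lambda>p. total_cost T \<pi> w f l Vf x (U p)) has_derivative
      (\<lambda>h. \<Sum>k \<in> nodes_range T 0 (int (horizon T) - 1). U' k h \<bullet>
        (\<Sum>j \<in> ch T k. \<pi> j *\<^sub>R l_u T w f l x (U p) j + f_u T w f x (U p) j (b j)))) (at p)"
proof -
  define u where "u = U p"
  define s where "s = state T w f x u"
  define Fx where "Fx j = frechet_derivative (\<lambda>\<xi>. f \<xi> (u (anc T j)) (w j)) (at (s (anc T j)))" for j
  define Fu where "Fu j = frechet_derivative (\<lambda>\<upsilon>. f (s (anc T j)) \<upsilon> (w j)) (at (u (anc T j)))" for j
  define Lx where "Lx j = frechet_derivative (\<lambda>\<xi>. l \<xi> (u (anc T j)) (w j)) (at (s (anc T j)))" for j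
  define Lu where "Lu j = frechet_derivative (\<lambda>\<upsilon>. l (s (anc T j)) \<upsilon> (w j)) (at (u (anc T j)))" for j
  \<comment> \<open>The linearised dynamics are dynamics on the same tree, with each node as its own disturbance.\<close>
  define X where
    "X j h = state T (\<lambda>j. j) (\<lambda>\<xi> \<upsilon> j. Fx j \<xi> + Fu j \<upsilon>) 0 (\<lambda>k. U' k h) j" for j h
  let ?I = "nodes_range T 1 (int (horizon T) - 1)"
  let ?A = "nodes_range T 0 (int (horizon T) - 1)"
  let ?B = "nodes_range T 1 (int (horizon T))"
  let ?L = "nodes T (horizon T)"

  have X_root: "X (root_node T) h = 0" for h
    unfolding X_def by (rule state_root[OF T])
  have X_step: "X j h = Fx j (X (anc T j) h) + Fu j (U' (anc T j) h)" if "j \<in> ?B" for j h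
    unfolding X_def by (rule state_step[OF T that])

  have fx: "\<xi> \<bullet> f_x T w f x u j d = Fx j \<xi> \<bullet> d" for \<xi> j d
    unfolding f_x_def Fx_def s_def
    by (rule inner_transpose_jacobian, rule differentiable_partial(1)[of "\<lambda>\<xi> \<upsilon>. f \<xi> \<upsilon> (w j)"],
      rule diff_f)
  have fu: "\<upsilon> \<bullet> f_u T w f x u j d = Fu j \<upsilon> \<bullet> d" for \<upsilon> j d
    unfolding f_u_def Fu_def s_def
    by (rule inner_transpose_jacobian, rule differentiable_partial(2)[of "\<lambda>\<xi> \<upsilon>. f \<xi> \<upsilon> (w j)"],
      rule diff_f)
  have lx: "\<xi> \<bullet> l_x T w f l x u j = Lx j \<xi>" for \<xi> j
    unfolding l_x_def Lx_def s_def
    by (rule inner_grad, rule differentiable_partial(1)[of "\<lambda>\<xi> \<upsilon>. l \<xi> \<upsilon> (w j)"], rule diff_l)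
  have lu: "\<upsilon> \<bullet> l_u T w f l x u j = Lu j \<upsilon>" for \<upsilon> j
    unfolding l_u_def Lu_def s_def
    by (rule inner_grad, rule differentiable_partial(2)[of "\<lambda>\<xi> \<upsilon>. l \<xi> \<upsilon> (w j)"], rule diff_l)

  have sub_A: "?A \<subseteq> nodes_range T 0 (int (horizon T))"
    unfolding nodes_range_def by (rule UN_mono) auto
  have sub_L: "?L \<subseteq> nodes_range T 0 (int (horizon T))"
    by (force simp: nodes_range_def)
  have dstate: "((\<lambda>p. state T w f x (U p) j) has_derivative X j) (at p)"
    if "j \<in> nodes_range T 0 (int (horizon T))" for j
    using T that
  proof (induction rule: scenario_tree_induct)
    case root
    have "X (root_node T) = (\<lambda>h. 0)"
      using X_root by blast
    then show ?case
      by (simp add: state_root[OF T])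
  next
    case (step j)
    have "((\<lambda>p. f (state T w f x (U p) (anc T j)) (U p (anc T j)) (w j)) has_derivative
        (\<lambda>h. Fx j (X (anc T j) h) + Fu j (U' (anc T j) h))) (at p)"
      unfolding Fx_def Fu_def s_def u_def
      by (rule has_derivative_two_arguments[where \<phi> = "\<lambda>\<xi> \<upsilon>. f \<xi> \<upsilon> (w j)"])
        (use diff_f step.IH U[OF anc_in_nodes_range[OF T step.hyps]] in auto)
    then show ?case
      unfolding state_step[OF T step.hyps] X_step[OF step.hyps, abs_def] .
  qed
  have dstage: "((\<lambda>p. l (state T w f x (U p) (anc T j)) (U p (anc T j)) (w j)) has_derivative
      (\<lambda>h. Lx j (X (anc T j) h) + Lu j (U' (anc T j) h))) (at p)" if "j \<in> ?B" for j
    unfolding Lx_def Lu_def s_def u_def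
    by (rule has_derivative_two_arguments[where \<phi> = "\<lambda>\<xi> \<upsilon>. l \<xi> \<upsilon> (w j)"])
      (use diff_l U[OF anc_in_nodes_range[OF T that]] dstate anc_in_nodes_range[OF T that] sub_A in auto)
  have dterm: "((\<lambda>p. \<pi> j * Vf (state T w f x (U p) j)) has_derivative (\<lambda>h. X j h \<bullet> b j)) (at p)"
    if j: "j \<in> ?L" for j
  proof -
    have "((\<lambda>p. Vf (state T w f x (U p) j)) has_derivative
        (\<lambda>h. frechet_derivative Vf (at (s j)) (X j h))) (at p)"
      unfolding s_def u_def
      by (rule has_derivative_compose[OF dstate]) (use j sub_L diff_Vf frechet_derivative_works in auto)
    then have "((\<lambda>p. \<pi> j * Vf (state T w f x (U p) j)) has_derivative
        (\<lambda>h. \<pi> j * frechet_derivative Vf (at (s j)) (X j h))) (at p)"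
      by (rule has_derivative_mult_right)
    then show ?thesis
      using inner_grad[OF diff_Vf] by (simp add: b_leaf[OF j] Vf_x_def s_def u_def)
  qed

  \<comment> \<open>Adding the sum of \<open>X\<^sup>j \<bullet> b\<^sup>j\<close> over all nonroot nodes to both sides makes the children sums match.\<close>
  have adjoint: "(\<Sum>j \<in> ?B. \<pi> j * (Lx j (X (anc T j) h) + Lu j (U' (anc T j) h))) +
      (\<Sum>j \<in> ?L. X j h \<bullet> b j) =
      (\<Sum>k \<in> ?A. U' k h \<bullet> (\<Sum>j \<in> ch T k. \<pi> j *\<^sub>R l_u T w f l x u j + f_u T w f x u j (b j)))"
    (is "?cost + ?leaf = ?grad") for h
  proof -
    let ?xpart = "\<lambda>k. \<Sum>j \<in> ch T k. \<pi> j *\<^sub>R l_x T w f l x u j + f_x T w f x u j (b j)"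
    let ?upart = "\<lambda>k. \<Sum>j \<in> ch T k. \<pi> j *\<^sub>R l_u T w f l x u j + f_u T w f x u j (b j)"
    have fin: "finite ?I" "finite ?L"
      using finite_nodes_range[OF T] T by (auto simp: scenario_tree_def)
    have "?cost + (\<Sum>j \<in> ?B. X j h \<bullet> b j) =
        (\<Sum>j \<in> ?B. X (anc T j) h \<bullet> (\<pi> j *\<^sub>R l_x T w f l x u j + f_x T w f x u j (b j)) +
          U' (anc T j) h \<bullet> (\<pi> j *\<^sub>R l_u T w f l x u j + f_u T w f x u j (b j)))"
      unfolding sum.distrib[symmetric]
      by (intro sum.cong refl)
        (simp add: X_step fx fu lx lu inner_add_left inner_add_right distrib_left)
    also have "\<dots> = (\<Sum>k \<in> ?A. X k h \<bullet> ?xpart k + U' k h \<bullet> ?upart k)"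
      unfolding sum_over_children[OF T] inner_sum_right sum.distrib[symmetric]
      by (intro sum.cong refl) (auto simp: ch_def)
    also have "\<dots> = (\<Sum>k \<in> ?A. X k h \<bullet> ?xpart k) + ?grad"
      by (rule sum.distrib)
    also have "(\<Sum>k \<in> ?A. X k h \<bullet> ?xpart k) = (\<Sum>k \<in> ?I. X k h \<bullet> ?xpart k)"
      using nodes_range_root[OF T, of "int (horizon T) - 1"] N fin X_root by simp
    also have "\<dots> = (\<Sum>k \<in> ?I. X k h \<bullet> b k)"
      using b_inner by (intro sum.cong) (simp_all add: u_def)
    finally show ?thesis
      unfolding nodes_range_leaves(1)[OF T N]
      using sum.union_disjoint[OF fin nodes_range_leaves(2)[OF T N], of "\<lambda>j. X j h \<bullet> b j"] by simp
  qed

  show ?thesis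
    unfolding total_cost_def u_def[symmetric] adjoint[symmetric]
    by (intro has_derivative_add has_derivative_sum has_derivative_mult_right dstage dterm)
qed

theorem mainTheorem2:
  fixes T :: "'i tree"
    and \<pi> :: "'i \<Rightarrow> real"
    and w :: "'i \<Rightarrow> 'w"
    and f :: "real^'nx \<Rightarrow> real^'nu \<Rightarrow> 'w \<Rightarrow> real^'nx"
    and l :: "real^'nx \<Rightarrow> real^'nu \<Rightarrow> 'w \<Rightarrow> real"
    and Vf :: "real^'nx \<Rightarrow> real"
    and x :: "real^'nx"
    and u :: "'i \<Rightarrow> real^'nu"
    and a :: "'i \<Rightarrow> real^'nx"
    and N :: nat
  assumes tree: "scenario_tree T" "horizon T = N" "1 \<le> N"
    and prob: "\<And>i. i \<in> nodes_range T 0 (int N) \<Longrightarrow> 0 < \<pi> i"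
    and diff_f: "\<And>\<omega> z. (\<lambda>(\<xi>, \<upsilon>). f \<xi> \<upsilon> \<omega>) differentiable (at z)"
    and diff_l: "\<And>\<omega> z. (\<lambda>(\<xi>, \<upsilon>). l \<xi> \<upsilon> \<omega>) differentiable (at z)"
    and diff_Vf: "\<And>z. Vf differentiable (at z)"
    and a_leaf: "\<And>i. i \<in> nodes T N \<Longrightarrow> a i = Vf_x T w f Vf x u i"
    and a_last: "\<And>i. i \<in> nodes T (N - 1) \<Longrightarrow>
      a i = (\<Sum>j \<in> ch T i. \<pi> j *\<^sub>R (l_x T w f l x u j + f_x T w f x u j (a j)))"
    and a_inner: "\<And>i. i \<in> nodes_range T 1 (int N - 2) \<Longrightarrow>
      a i = (\<Sum>j \<in> ch T i. \<pi> j *\<^sub>R l_x T w f l x u j + f_x T w f x u j (a j))"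
  shows "(\<forall>i \<in> nodes T (N - 1).
            GDERIV (\<lambda>v. total_cost T \<pi> w f l Vf x (u(i := v))) (u i) :>
              (\<Sum>j \<in> ch T i. \<pi> j *\<^sub>R (l_u T w f l x u j + f_u T w f x u j (a j)))) \<and>
         (\<forall>i \<in> nodes_range T 0 (int N - 2).
            GDERIV (\<lambda>v. total_cost T \<pi> w f l Vf x (u(i := v))) (u i) :>
              (\<Sum>j \<in> ch T i. \<pi> j *\<^sub>R l_u T w f l x u j + f_u T w f x u j (a j)))"
proof -
  let ?R = "\<lambda>t. nodes_range T 0 (int N - t)"
  \<comment> \<open>The factor at the leaves turns \<open>f\<^sub>x b = f\<^sub>x (\<pi> a)\<close> into the \<open>\<pi> f\<^sub>x a\<close> of the last stage.\<close>
  define b where "b j = (if j \<in> nodes T N then \<pi> j *\<^sub>R a j else a j)" for j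
  have stage: "stage T i = t" if "i \<in> nodes T t" "t \<le> N" for i t
    using stage_eq[OF tree(1)] that tree(2) by simp
  have ch_stage: "j \<in> nodes T (Suc t)" if i: "i \<in> nodes T t" "t < N" and j: "j \<in> ch T i" for i j t
  proof -
    obtain s where s: "1 \<le> s" "s \<le> N" "j \<in> nodes T s" "anc T j = i"
      using j tree by (auto simp: ch_def nodes_range_def)
    then have "i \<in> nodes T (s - 1)"
      using tree unfolding scenario_tree_def
      by (metis Suc_le_lessD Suc_pred One_nat_def)
    then have "t = s - 1"
      using stage[of i t] stage[of i "s - 1"] i s by simp
    then show ?thesis
      using s by simp
  qed
  have b_last: "b j = \<pi> j *\<^sub>R a j" if "i \<in> nodes T (N - 1)" "j \<in> ch T i" for i j
    using ch_stage[OF that(1) _ that(2)] tree by (simp add: b_def)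
  have b_before: "b j = a j" if "i \<in> nodes T t" "t < N - 1" "j \<in> ch T i" for i j t
    using ch_stage[OF that(1) _ that(3)] stage[of j "Suc t"] stage[of j N] that(2)
    by (auto simp: b_def)
  have f_x_scale: "f_x T w f x u j (c *\<^sub>R d) = c *\<^sub>R f_x T w f x u j d"
    and f_u_scale: "f_u T w f x u j (c *\<^sub>R d) = c *\<^sub>R f_u T w f x u j d" for j c d
    by (simp_all add: f_x_def f_u_def matrix_vector_mult_scaleR)
  have b_inner: "b k = (\<Sum>j \<in> ch T k. \<pi> j *\<^sub>R l_x T w f l x u j + f_x T w f x u j (b j))"
    if k: "k \<in> nodes_range T 1 (int (horizon T) - 1)" for k
  proof -
    obtain t where t: "1 \<le> t" "t \<le> N - 1" "k \<in> nodes T t"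
      using k tree by (auto simp: nodes_range_def)
    have bk: "b k = a k"
      using stage[of k t] stage[of k N] t tree by (auto simp: b_def)
    show ?thesis
    proof (cases "t = N - 1")
      case True
      then show ?thesis
        using t bk a_last[of k]
        by (auto intro!: sum.cong simp: b_last f_x_scale scaleR_add_right)
    next
      case False
      then have "k \<in> nodes_range T 1 (int N - 2)"
        using t unfolding nodes_range_def by force
      then show ?thesis
        using t False bk a_inner[of k] b_before[of k t] by simp
    qed
  qed
  have gradient: "GDERIV (\<lambda>v. total_cost T \<pi> w f l Vf x (u(i := v))) (u i) :>
      (\<Sum>j \<in> ch T i. \<pi> j *\<^sub>R l_u T w f l x u j + f_u T w f x u j (b j))" (is "GDERIV _ _ :> ?g i")
    if i: "i \<in> ?R 1" for i
  proof -
    have "((\<lambda>v. total_cost T \<pi> w f l Vf x (u(i := v))) has_derivative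
        (\<lambda>h. \<Sum>k \<in> ?R 1. (if k = i then h else 0) \<bullet> ?g k)) (at (u i))"
      unfolding tree(2)[symmetric]
    proof (rule total_cost_has_derivative[where U = "\<lambda>v. u(i := v)" and p = "u i"
          and U' = "\<lambda>k h. if k = i then h else 0", unfolded fun_upd_triv,
          OF tree(1) _ diff_f diff_l diff_Vf _ _ b_inner])
      show "1 \<le> horizon T"
        using tree by simp
      show "((\<lambda>v. (u(i := v)) k) has_derivative (\<lambda>h. if k = i then h else 0)) (at (u i))" for k
        by (cases "k = i") auto
      show "b j = \<pi> j *\<^sub>R Vf_x T w f Vf x u j" if "j \<in> nodes T (horizon T)" for j
        using that tree a_leaf by (simp add: b_def)
    qed
    moreover have "(\<Sum>k \<in> ?R 1. (if k = i then h else 0) \<bullet> ?g k) = h \<bullet> ?g i" for h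
    proof -
      have "(\<Sum>k \<in> ?R 1. (if k = i then h else 0) \<bullet> ?g k) =
          (\<Sum>k \<in> ?R 1. if k = i then h \<bullet> ?g k else 0)"
        by (intro sum.cong) auto
      also have "\<dots> = h \<bullet> ?g i"
        using i finite_nodes_range[OF tree(1), of "int N - 1" 0] tree by simp
      finally show ?thesis .
    qed
    ultimately show ?thesis
      by (simp add: gderiv_def)
  qed
  show ?thesis
  proof (intro conjI ballI)
    fix i assume i: "i \<in> nodes T (N - 1)"
    then have "i \<in> ?R 1"
      using tree unfolding nodes_range_def by force
    moreover have "?g i = (\<Sum>j \<in> ch T i. \<pi> j *\<^sub>R (l_u T w f l x u j + f_u T w f x u j (a j)))"
      using b_last[OF i] by (intro sum.cong) (simp_all add: f_u_scale scaleR_add_right)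
    ultimately show "GDERIV (\<lambda>v. total_cost T \<pi> w f l Vf x (u(i := v))) (u i) :>
        (\<Sum>j \<in> ch T i. \<pi> j *\<^sub>R (l_u T w f l x u j + f_u T w f x u j (a j)))"
      using gradient[of i] by simp
  next
    fix i assume i: "i \<in> ?R 2"
    then obtain t where t: "i \<in> nodes T t" "t < N - 1"
      by (auto simp: nodes_range_def)
    have "i \<in> ?R 1"
      using t unfolding nodes_range_def by force
    moreover have "?g i = (\<Sum>j \<in> ch T i. \<pi> j *\<^sub>R l_u T w f l x u j + f_u T w f x u j (a j))"
      using b_before[OF t] by (intro sum.cong) simp_all
    ultimately show "GDERIV (\<lambda>v. total_cost T \<pi> w f l Vf x (u(i := v))) (u i) :>
        (\<Sum>j \<in> ch T i. \<pi> j *\<^sub>R l_u T w f l x u j + f_u T w f x u j (a j))"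
      using gradient[of i] by simp
  qed
qed

end
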